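(* Let $\kappa$ be a constant. Any (local) solution to the system $$\begin{array}{l} 2EF_u-FE_u-EE_v=0,\\ 2GF_v-FG_v-GG_u=0,\\ GE_u+EG_v-2F(F_u+F_v)+(3F-2G)E_v+(3F-2E)G_u=0,\end{array}$$ invariant with respect to the operator $\partial_u+\kappa\,\partial_v+E\partial_E+F\partial_F+G\partial_G$, is given by $E=\exp(u)e(s)$, $G=\exp(u)j(s)$, $F=\exp(u)f(s)$, where $s=v-\kappa u$ and $e,j,f$ solve the ODEs $$\begin{array}{l} e'=\frac1\delta(\kappa+1)e(f-\kappa j),\\[2pt] j'=\frac1\delta\, j\left(-j\kappa^2+(2f-2j)\kappa+e\right),\\[2pt] f'=\frac1{2\delta}\left(-2fj\kappa^2+(2f^2-3fj+je)\kappa+e(f+j)\right),\end{array}$$ with $\delta=-j\kappa^3+(f-2j)\kappa^2+(2e-f)\kappa+e$. The Gaussian curvature of the corresponding surface, with metric $E\,du^2+2F\,du\,dv+G\,dv^2$, is constant if and only if $\kappa\in\{0,-1\}$. Moreover, for these values of $\kappa$, the metric is flat.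
   Context: Solutions are local and satisfy the geometric restrictions $E>0$, $EG-F^2>0$ (the quadratic form $E\,du^2+2F\,du\,dv+G\,dv^2$ is positive definite). A solution is invariant with respect to a vector field $X$ on $\mathbb R^5$ (with coordinates $u,v,E,F,G$) if $X$ is tangent to the surface $\{(u,v,E(u,v),F(u,v),G(u,v))\}\subset\mathbb R^5$. Prime denotes $d/ds$. *)

theory Defs
  imports "HOL-Analysis.Analysis"
begin

definition partial_u :: "(real \<times> real \<Rightarrow> real) \<Rightarrow> real \<times> real \<Rightarrow> real" where
  "partial_u f = (\<lambda>(u, v). deriv (\<lambda>x. f (x, v)) u)"

definition partial_v :: "(real \<times> real \<Rightarrow> real) \<Rightarrow> real \<times> real \<Rightarrow> real" where
  "partial_v f = (\<lambda>(u, v). deriv (\<lambda>y. f (u, y)) v)"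

definition C1_on :: "(real \<times> real) set \<Rightarrow> (real \<times> real \<Rightarrow> real) \<Rightarrow> bool" where
  "C1_on U f \<longleftrightarrow> (\<forall>p\<in>U. f differentiable (at p)) \<and>
     continuous_on U (partial_u f) \<and> continuous_on U (partial_v f)"

text \<open>Class \<open>C\<^sup>2\<close> is the regularity needed for the Gaussian curvature
  of the metric to be defined.\<close>

definition C2_on :: "(real \<times> real) set \<Rightarrow> (real \<times> real \<Rightarrow> real) \<Rightarrow> bool" where
  "C2_on U f \<longleftrightarrow> C1_on U f \<and> C1_on U (partial_u f) \<and> C1_on U (partial_v f)"

definition pos_def_metric_on ::
  "(real \<times> real) set \<Rightarrow> (real \<times> real \<Rightarrow> real) \<Rightarrow> (real \<times> real \<Rightarrow> real) \<Rightarrow> (real \<times> real \<Rightarrow> real) \<Rightarrow> bool" where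
  "pos_def_metric_on U E F G \<longleftrightarrow> (\<forall>p\<in>U. E p > 0 \<and> E p * G p - (F p)\<^sup>2 > 0)"

definition solves_system_on ::
  "(real \<times> real) set \<Rightarrow> (real \<times> real \<Rightarrow> real) \<Rightarrow> (real \<times> real \<Rightarrow> real) \<Rightarrow> (real \<times> real \<Rightarrow> real) \<Rightarrow> bool" where
  "solves_system_on U E F G \<longleftrightarrow> C2_on U E \<and> C2_on U F \<and> C2_on U G \<and>
    (\<forall>p\<in>U.
      2 * E p * partial_u F p - F p * partial_u E p - E p * partial_v E p = 0 \<and>
      2 * G p * partial_v F p - F p * partial_v G p - G p * partial_u G p = 0 \<and>
      G p * partial_u E p + E p * partial_v G p - 2 * F p * (partial_u F p + partial_v F p)
        + (3 * F p - 2 * G p) * partial_v E p + (3 * F p - 2 * E p) * partial_u G p = 0)"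

type_synonym R5 = "real \<times> real \<times> real \<times> real \<times> real"

definition graph_param ::
  "(real \<times> real \<Rightarrow> real) \<Rightarrow> (real \<times> real \<Rightarrow> real) \<Rightarrow> (real \<times> real \<Rightarrow> real) \<Rightarrow> real \<times> real \<Rightarrow> R5" where
  "graph_param E F G = (\<lambda>(u, v). (u, v, E (u, v), F (u, v), G (u, v)))"

text \<open>The tangent space of the graph surface at a point is the image of the differential
  of its parametrization.\<close>

definition invariant_on ::
  "(R5 \<Rightarrow> R5) \<Rightarrow> (real \<times> real) set \<Rightarrow> (real \<times> real \<Rightarrow> real) \<Rightarrow> (real \<times> real \<Rightarrow> real) \<Rightarrow> (real \<times> real \<Rightarrow> real) \<Rightarrow> bool" where
  "invariant_on X U E F G \<longleftrightarrow>
    (\<forall>p\<in>U. X (graph_param E F G p) \<in> range (frechet_derivative (graph_param E F G) (at p)))"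

definition symmetry_field :: "real \<Rightarrow> R5 \<Rightarrow> R5" where
  "symmetry_field \<kappa> = (\<lambda>(u, v, E, F, G). (1, \<kappa>, E, F, G))"

definition ode_delta :: "real \<Rightarrow> real \<Rightarrow> real \<Rightarrow> real \<Rightarrow> real" where
  "ode_delta \<kappa> e j f = - j * \<kappa>^3 + (f - 2 * j) * \<kappa>\<^sup>2 + (2 * e - f) * \<kappa> + e"

text \<open>The condition \<open>\<delta> \<noteq> 0\<close> makes explicit that the right-hand sides are defined,
  since division by zero is total in HOL.\<close>

definition solves_odes_on ::
  "real \<Rightarrow> real set \<Rightarrow> (real \<Rightarrow> real) \<Rightarrow> (real \<Rightarrow> real) \<Rightarrow> (real \<Rightarrow> real) \<Rightarrow> bool" where
  "solves_odes_on \<kappa> I e j f \<longleftrightarrow>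
    (\<forall>s\<in>I. let \<delta> = ode_delta \<kappa> (e s) (j s) (f s) in
      \<delta> \<noteq> 0 \<and>
      (e has_real_derivative
        1 / \<delta> * (\<kappa> + 1) * e s * (f s - \<kappa> * j s)) (at s) \<and>
      (j has_real_derivative
        1 / \<delta> * j s * (- j s * \<kappa>\<^sup>2 + (2 * f s - 2 * j s) * \<kappa> + e s)) (at s) \<and>
      (f has_real_derivative
        1 / (2 * \<delta>) * (- 2 * f s * j s * \<kappa>\<^sup>2
          + (2 * (f s)\<^sup>2 - 3 * f s * j s + j s * e s) * \<kappa> + e s * (f s + j s))) (at s))"

text \<open>Brioschi's formula for the Gaussian curvature of
  \<open>E du\<^sup>2 + 2 F du dv + G dv\<^sup>2\<close>.\<close>

definition gauss_curvature ::
  "(real \<times> real \<Rightarrow> real) \<Rightarrow> (real \<times> real \<Rightarrow> real) \<Rightarrow> (real \<times> real \<Rightarrow> real) \<Rightarrow> real \<times> real \<Rightarrow> real" where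
  "gauss_curvature E F G p =
    (det (vector
       [vector [- partial_v (partial_v E) p / 2 + partial_v (partial_u F) p - partial_u (partial_u G) p / 2,
                partial_u E p / 2, partial_u F p - partial_v E p / 2],
        vector [partial_v F p - partial_u G p / 2, E p, F p],
        vector [partial_v G p / 2, F p, G p]] :: real^3^3)
     - det (vector
       [vector [0, partial_v E p / 2, partial_u G p / 2],
        vector [partial_v E p / 2, E p, F p],
        vector [partial_u G p / 2, F p, G p]] :: real^3^3))
    / (E p * G p - (F p)\<^sup>2)\<^sup>2"

definition flat_on ::
  "(real \<times> real) set \<Rightarrow> (real \<times> real \<Rightarrow> real) \<Rightarrow> (real \<times> real \<Rightarrow> real) \<Rightarrow> (real \<times> real \<Rightarrow> real) \<Rightarrow> bool" where
  "flat_on U E F G \<longleftrightarrow> (\<forall>p\<in>U. gauss_curvature E F G p = 0)"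

text \<open>The representation is required on convex open subsets \<open>V\<close> of the domain: there every line
  on which \<open>s = v - \<kappa> u\<close> is constant meets \<open>V\<close> in a connected set, so that \<open>e\<close>, \<open>j\<close>, \<open>f\<close>
  are single-valued functions of \<open>s\<close>; on a general domain this may fail globally.\<close>

definition reduced_form_on ::
  "real \<Rightarrow> (real \<times> real) set \<Rightarrow> (real \<times> real \<Rightarrow> real) \<Rightarrow> (real \<times> real \<Rightarrow> real) \<Rightarrow> (real \<times> real \<Rightarrow> real) \<Rightarrow> bool" where
  "reduced_form_on \<kappa> V E F G \<longleftrightarrow>
    (\<exists>e j f.
      (\<forall>(u, v)\<in>V. E (u, v) = exp u * e (v - \<kappa> * u) \<and>
                   G (u, v) = exp u * j (v - \<kappa> * u) \<and>
                   F (u, v) = exp u * f (v - \<kappa> * u)) \<and>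
      solves_odes_on \<kappa> ((\<lambda>(u, v). v - \<kappa> * u) ` V) e j f)"

end

theory Submission
  imports Defs
begin

text \<open>
  Tangency to the symmetry field says \<open>E\<^sub>u + \<kappa> E\<^sub>v = E\<close>, and likewise for \<open>F\<close> and \<open>G\<close>, so that
  \<open>exp (- u) E\<close> is constant along the lines \<open>v - \<kappa> u = s\<close>. For the profiles \<open>e, j, f\<close> the system
  becomes linear in \<open>e', j', f'\<close> with determinant \<open>2 \<delta> (e j - f\<^sup>2)\<close>. If \<open>\<delta>\<close> vanished at a point,
  then so would the Cramer numerators, which positive definiteness excludes; hence the system is
  equivalent to the ODEs.

  Substituting the ODEs into Brioschi's formula gives
  \<open>K = exp (- u) \<kappa> (\<kappa> + 1) R / (4 \<delta>\<^sup>3)\<close> with a form \<open>R\<close> that is quadratic in \<open>e, j, f\<close>. The factor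
  \<open>exp (- u)\<close> forces a constant \<open>K\<close> to vanish, so for \<open>\<kappa> \<noteq> 0, -1\<close> also \<open>R = 0\<close> and \<open>R' = 0\<close>. For
  \<open>\<kappa> = 1\<close> the first equation already forces \<open>\<delta> = 0\<close>; otherwise the two determine the ratio \<open>e / j\<close>,
  and differentiating once more yields
  \<open>3 \<kappa> (\<kappa> + 1)\<^sup>3 j = 0\<close>.
\<close>

subsection \<open>Partial derivatives and invariance\<close>

text \<open>Along a coordinate line \<open>f\<close> is composed with an affine map, so the chain
  rule turns the Frechet derivative into the one-variable \<open>deriv\<close> of the
  definitions.\<close>

lemma partial_eqs:
  assumes "(f has_derivative f') (at p)"
  shows partial_u_eq: "partial_u f p = f' (1, 0)" and partial_v_eq: "partial_v f p = f' (0, 1)"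
proof -
  obtain u v where p: "p = (u, v)" by (cases p)
  interpret bounded_linear f' using assms by (rule has_derivative_bounded_linear)
  have "((\<lambda>x. f (x, v)) has_derivative (\<lambda>h. f' (h, 0))) (at u)"
    using has_derivative_compose[OF has_derivative_Pair[OF has_derivative_ident has_derivative_const] assms[unfolded p], of UNIV] .
  moreover have "(\<lambda>h. f' (h, 0)) = (*) (f' (1, 0))"
  proof
    fix h show "f' (h, 0) = f' (1, 0) * h"
      using scale[of h "(1, 0)"] by simp
  qed
  ultimately have "((\<lambda>x. f (x, v)) has_real_derivative f' (1, 0)) (at u)"
    by (simp add: has_field_derivative_def)
  then show "partial_u f p = f' (1, 0)"
    by (simp add: partial_u_def p DERIV_imp_deriv)
  have "((\<lambda>y. f (u, y)) has_derivative (\<lambda>h. f' (0, h))) (at v)"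
    using has_derivative_compose[OF has_derivative_Pair[OF has_derivative_const has_derivative_ident] assms[unfolded p], of UNIV] .
  moreover have "(\<lambda>h. f' (0, h)) = (*) (f' (0, 1))"
  proof
    fix h show "f' (0, h) = f' (0, 1) * h"
      using scale[of h "(0, 1)"] by simp
  qed
  ultimately have "((\<lambda>y. f (u, y)) has_real_derivative f' (0, 1)) (at v)"
    by (simp add: has_field_derivative_def)
  then show "partial_v f p = f' (0, 1)"
    by (simp add: partial_v_def p DERIV_imp_deriv)
qed

lemma has_derivative_partials:
  assumes "f differentiable (at p)"
  shows "(f has_derivative (\<lambda>(h, k). h * partial_u f p + k * partial_v f p)) (at p)"
proof -
  obtain f' where f': "(f has_derivative f') (at p)"
    using assms by (auto simp: differentiable_def)
  interpret bounded_linear f' using f' by (rule has_derivative_bounded_linear)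
  have "f' (h, k) = h * partial_u f p + k * partial_v f p" for h k
    using add[of "(h, 0)" "(0, k)"] scale[of h "(1, 0)"] scale[of k "(0, 1)"]
    by (simp add: partial_eqs[OF f'])
  then have "f' = (\<lambda>(h, k). h * partial_u f p + k * partial_v f p)" by auto
  with f' show ?thesis by simp
qed

text \<open>Differentiability and, on an open set, continuity are conditions at single points. This
  later carries regularity from balls to the whole domain.\<close>

lemma C1_on_local:
  assumes "open U" "\<And>p. p \<in> U \<Longrightarrow> \<exists>V. open V \<and> p \<in> V \<and> C1_on V f"
  shows "C1_on U f"
  unfolding C1_on_def continuous_on_eq_continuous_at[OF assms(1)]
  using assms(2) by (metis C1_on_def continuous_on_eq_continuous_at)

lemma C2_on_local:
  assumes "open U" "\<And>p. p \<in> U \<Longrightarrow> \<exists>V. open V \<and> p \<in> V \<and> C2_on V f"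
  shows "C2_on U f"
  unfolding C2_on_def using assms(2) by (meson C1_on_local[OF assms(1)] C2_on_def)

text \<open>The first two components of the differential reproduce its argument, so the only
  possible preimage of the field is \<open>(1, \<kappa>)\<close>; the other three components are the
  equations.\<close>

lemma tangent_symmetry_field_iff:
  assumes "E differentiable (at p)" "F differentiable (at p)" "G differentiable (at p)"
  shows "symmetry_field \<kappa> (graph_param E F G p) \<in> range (frechet_derivative (graph_param E F G) (at p)) \<longleftrightarrow>
    partial_u E p + \<kappa> * partial_v E p = E p \<and>
    partial_u F p + \<kappa> * partial_v F p = F p \<and>
    partial_u G p + \<kappa> * partial_v G p = G p"
proof -
  let ?D = "\<lambda>f h. fst h * partial_u f p + snd h * partial_v f p"
  have g: "graph_param E F G = (\<lambda>p. (fst p, snd p, E p, F p, G p))"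
    by (auto simp: graph_param_def)
  have "(graph_param E F G has_derivative (\<lambda>h. (fst h, snd h, ?D E h, ?D F h, ?D G h))) (at p)"
    unfolding g
    by (intro has_derivative_Pair has_derivative_fst has_derivative_snd has_derivative_ident
        assms[THEN has_derivative_partials, unfolded case_prod_beta])
  then have "frechet_derivative (graph_param E F G) (at p) = (\<lambda>h. (fst h, snd h, ?D E h, ?D F h, ?D G h))"
    by (rule frechet_derivative_at[symmetric])
  then show ?thesis
    by (auto simp: g symmetry_field_def image_iff)
qed

subsection \<open>Functions of the form \<open>exp u * g (v - \<kappa> * u)\<close>\<close>

text \<open>The shape that the method of characteristics gives for solutions of
  \<open>f\<^sub>u + \<kappa> f\<^sub>v = f\<close>; see \<open>profile_exists\<close>.\<close>

definition lift :: "real \<Rightarrow> (real \<Rightarrow> real) \<Rightarrow> real \<times> real \<Rightarrow> real" where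
  "lift \<kappa> g = (\<lambda>(u, v). exp u * g (v - \<kappa> * u))"

abbreviation inv_coord :: "real \<Rightarrow> real \<times> real \<Rightarrow> real" where
  "inv_coord \<kappa> \<equiv> \<lambda>(u, v). v - \<kappa> * u"

lemma has_derivative_lift:
  assumes "(g has_real_derivative g') (at (inv_coord \<kappa> p))"
  shows "(lift \<kappa> g has_derivative
    (\<lambda>h. exp (fst p) * (fst h * (g (inv_coord \<kappa> p) - \<kappa> * g') + snd h * g'))) (at p)"
proof -
  have s: "(inv_coord \<kappa> has_derivative (\<lambda>h. snd h - \<kappa> * fst h)) (at p)"
    unfolding case_prod_beta by (auto intro!: derivative_eq_intros)
  have "((\<lambda>q. g (inv_coord \<kappa> q)) has_derivative (\<lambda>h. g' * (snd h - \<kappa> * fst h))) (at p)"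
    using has_derivative_compose[OF s, of g "(*) g'"] assms by (simp add: has_field_derivative_def)
  moreover have "((\<lambda>q. exp (fst q)) has_derivative (\<lambda>h. exp (fst p) * fst h)) (at p)"
    by (auto intro!: derivative_eq_intros)
  ultimately have "((\<lambda>q. exp (fst q) * g (inv_coord \<kappa> q)) has_derivative
      (\<lambda>h. exp (fst p) * (g' * (snd h - \<kappa> * fst h)) + exp (fst p) * fst h * g (inv_coord \<kappa> p))) (at p)"
    by (rule has_derivative_mult[rotated])
  then show ?thesis
    unfolding lift_def case_prod_beta by (simp add: algebra_simps)
qed

text \<open>\<open>f\<close> is arbitrary outside \<open>V\<close>; since \<open>V\<close> is open,
  agreement on \<open>V\<close> determines its derivatives there.\<close>

locale lifted =
  fixes \<kappa> :: real and V :: "(real \<times> real) set" and f :: "real \<times> real \<Rightarrow> real" and g g' :: "real \<Rightarrow> real"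
  assumes open_V: "open V"
    and f_eq: "\<And>p. p \<in> V \<Longrightarrow> f p = lift \<kappa> g p"
    and deriv_g: "\<And>s. s \<in> inv_coord \<kappa> ` V \<Longrightarrow> (g has_real_derivative g' s) (at s)"
begin

lemma has_derivative:
  assumes "p \<in> V"
  shows "(f has_derivative (\<lambda>h. fst h * lift \<kappa> (\<lambda>s. g s - \<kappa> * g' s) p + snd h * lift \<kappa> g' p)) (at p)"
proof -
  have "(f has_derivative
    (\<lambda>h. exp (fst p) * (fst h * (g (inv_coord \<kappa> p) - \<kappa> * g' (inv_coord \<kappa> p)) + snd h * g' (inv_coord \<kappa> p)))) (at p)"
    by (rule has_derivative_transform_within_open[OF has_derivative_lift[OF deriv_g] open_V assms])
       (use assms f_eq in auto)
  then show ?thesis by (simp add: lift_def case_prod_beta algebra_simps)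
qed

lemma
  assumes "p \<in> V"
  shows differentiable: "f differentiable (at p)"
    and partial_u: "partial_u f p = lift \<kappa> (\<lambda>s. g s - \<kappa> * g' s) p"
    and partial_v: "partial_v f p = lift \<kappa> g' p"
  using has_derivative[OF assms] partial_eqs[OF has_derivative[OF assms]]
  by (auto simp: differentiable_def)

lemma C1:
  assumes "continuous_on (inv_coord \<kappa> ` V) g'"
  shows "C1_on V f"
proof -
  have "continuous_on (inv_coord \<kappa> ` V) g"
    using deriv_g by (intro continuous_at_imp_continuous_on ballI DERIV_isCont)
  then have "continuous_on V (lift \<kappa> (\<lambda>s. g s - \<kappa> * g' s))" "continuous_on V (lift \<kappa> g')"
    using assms unfolding lift_def case_prod_beta
    by (auto intro!: continuous_intros elim!: continuous_on_compose2)
  then have "continuous_on V (partial_u f)" "continuous_on V (partial_v f)"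
    by (auto elim!: continuous_on_eq simp: partial_u partial_v)
  then show ?thesis
    using differentiable by (simp add: C1_on_def)
qed

end

text \<open>Two points of \<open>V\<close> with equal \<open>v - \<kappa> u\<close> are joined by a
  segment in \<open>V\<close>, by convexity, and \<open>exp (- u) f\<close> has derivative zero
  along it. So this product depends on \<open>v - \<kappa> u\<close> alone.\<close>

lemma profile_exists:
  assumes V: "open V" "convex V"
    and diff: "\<And>p. p \<in> V \<Longrightarrow> f differentiable (at p)"
    and inv: "\<And>p. p \<in> V \<Longrightarrow> partial_u f p + \<kappa> * partial_v f p = f p"
  obtains g where "\<And>p. p \<in> V \<Longrightarrow> f p = lift \<kappa> g p"
    and "\<And>p. p \<in> V \<Longrightarrow> (g has_real_derivative exp (- fst p) * partial_v f p) (at (inv_coord \<kappa> p))"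
proof -
  have same: "exp (- fst p) * f p = exp (- fst q) * f q"
    if pq: "p \<in> V" "q \<in> V" "inv_coord \<kappa> p = inv_coord \<kappa> q" for p q
  proof -
    let ?r = "\<lambda>t. p + t *\<^sub>R (q - p)"
    have r: "?r t \<in> V" if "t \<in> {0..1}" for t
    proof -
      have "?r t = (1 - t) *\<^sub>R p + t *\<^sub>R q" by (simp add: algebra_simps)
      then show ?thesis using V(2) pq that by (simp add: convex_alt)
    qed
    \<comment> \<open>The direction of the segment is a multiple of \<open>(1, \<kappa>)\<close>,
      where \<open>inv\<close> gives the derivative of \<open>f\<close>.\<close>
    have sq: "snd q - snd p = \<kappa> * (fst q - fst p)"
      using pq(3) by (simp add: case_prod_beta algebra_simps)
    have der: "((\<lambda>t. exp (- fst (?r t)) * f (?r t)) has_real_derivative 0) (at t within {0..1})"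
      if t: "t \<in> {0..1}" for t
    proof -
      have 1: "(?r has_derivative (\<lambda>h. h *\<^sub>R (q - p))) (at t within {0..1})"
        by (auto intro!: derivative_eq_intros)
      have "((\<lambda>t. f (?r t)) has_derivative (\<lambda>h. (\<lambda>(h, k). h * partial_u f (?r t) + k * partial_v f (?r t)) (h *\<^sub>R (q - p)))) (at t within {0..1})"
        by (rule has_derivative_compose[OF 1 has_derivative_partials[OF diff[OF r[OF t]]]])
      moreover have "(\<lambda>(h, k). h * partial_u f (?r t) + k * partial_v f (?r t)) (h *\<^sub>R (q - p))
          = (fst q - fst p) * f (?r t) * h" for h
      proof -
        have "(\<lambda>(h, k). h * partial_u f (?r t) + k * partial_v f (?r t)) (h *\<^sub>R (q - p))
          = h * ((fst q - fst p) * partial_u f (?r t) + (snd q - snd p) * partial_v f (?r t))"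
          by (simp add: case_prod_beta distrib_left)
        then show ?thesis
          unfolding sq inv[OF r[OF t], symmetric] by (simp add: algebra_simps)
      qed
      ultimately have "((\<lambda>t. f (?r t)) has_real_derivative (fst q - fst p) * f (?r t)) (at t within {0..1})"
        by (simp add: has_field_derivative_def)
      then show ?thesis
        by (auto intro!: derivative_eq_intros simp: algebra_simps)
    qed
    have "\<exists>c. \<forall>t\<in>{0..1}. exp (- fst (?r t)) * f (?r t) = c"
      using der by (intro has_field_derivative_zero_constant) auto
    then obtain c where c: "\<And>t. t \<in> {0..1} \<Longrightarrow> exp (- fst (?r t)) * f (?r t) = c"
      by blast
    show ?thesis using c[of 0] c[of 1] by simp
  qed
  \<comment> \<open>Any point of \<open>V\<close> on the line may represent it; \<open>same\<close>
    makes the choice irrelevant.\<close>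
  define g where "g s = (let p = (SOME p. p \<in> V \<and> inv_coord \<kappa> p = s) in exp (- fst p) * f p)" for s
  have g: "g (inv_coord \<kappa> p) = exp (- fst p) * f p" if "p \<in> V" for p
    unfolding g_def Let_def
    by (rule someI2[of _ p]) (use that same in blast)+
  have "f p = lift \<kappa> g p" if "p \<in> V" for p
    using g[OF that] by (simp add: lift_def case_prod_beta exp_minus)
  moreover have "(g has_real_derivative exp (- fst p) * partial_v f p) (at (inv_coord \<kappa> p))" if p: "p \<in> V" for p
  proof -
    obtain u v where uv: "p = (u, v)" by (cases p)
    \<comment> \<open>At fixed \<open>u\<close> the vertical line is parametrised by
      \<open>s\<close>, so near the given point \<open>g\<close> is \<open>exp (- u)\<close> times
      the restriction of \<open>f\<close> to that line.\<close>
    let ?r = "\<lambda>s. (u, s + \<kappa> * u)"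
    have 1: "(?r has_derivative (\<lambda>h. (0, h))) (at (v - \<kappa> * u))"
      by (auto intro!: derivative_eq_intros)
    have 2: "(f has_derivative (\<lambda>(h, k). h * partial_u f p + k * partial_v f p)) (at (?r (v - \<kappa> * u)))"
      using has_derivative_partials[OF diff[OF p]] uv by simp
    have "((\<lambda>s. f (?r s)) has_real_derivative partial_v f p) (at (v - \<kappa> * u))"
      using has_derivative_compose[OF 1 2] by (simp add: has_field_derivative_def mult_commute_abs)
    then have 3: "((\<lambda>s. exp (- u) * f (?r s)) has_real_derivative exp (- u) * partial_v f p) (at (v - \<kappa> * u))"
      by (auto intro!: derivative_eq_intros)
    have "open (?r -` V)"
      by (intro open_vimage V(1) continuous_intros)
    then have "(g has_real_derivative exp (- u) * partial_v f p) (at (v - \<kappa> * u))"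
      by (rule has_field_derivative_transform_within_open[OF 3]) (use p uv g in \<open>auto dest!: g\<close>)
    then show ?thesis by (simp add: uv)
  qed
  ultimately show thesis using that by blast
qed

subsection \<open>Algebra of the reduced system\<close>

text \<open>Both determinants in Brioschi's formula have the matrix of the metric as lower right
  block, so one expansion serves for both.\<close>

lemma det_bordered:
  fixes x y z r t E F G :: real
  shows "det (vector [vector [x, y, z], vector [r, E, F], vector [t, F, G]] :: real^3^3)
    = x * (E * G - F\<^sup>2) - y * (r * G - F * t) + z * (r * F - E * t)"
  unfolding det_3 vector_3 by algebra

text \<open>The numerator of Brioschi's formula with all derivatives as independent real variables,
  so that the curvature becomes polynomial algebra.\<close>

definition brioschi_num ::
  "real \<Rightarrow> real \<Rightarrow> real \<Rightarrow> real \<Rightarrow> real \<Rightarrow> real \<Rightarrow> real \<Rightarrow> real \<Rightarrow> real \<Rightarrow> real \<Rightarrow> real \<Rightarrow> real \<Rightarrow> real" where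
  "brioschi_num Evv Fuv Guu E F G Eu Ev Fu Fv Gu Gv =
    (- Evv / 2 + Fuv - Guu / 2) * (E * G - F\<^sup>2)
    - Eu / 2 * ((Fv - Gu / 2) * G - F * (Gv / 2))
    + (Fu - Ev / 2) * ((Fv - Gu / 2) * F - E * (Gv / 2))
    + Ev / 2 * (Ev / 2 * G - F * (Gu / 2))
    - Gu / 2 * (Ev / 2 * F - E * (Gu / 2))"

lemma gauss_curvature_eq_brioschi:
  "gauss_curvature E F G p =
    brioschi_num (partial_v (partial_v E) p) (partial_v (partial_u F) p) (partial_u (partial_u G) p)
      (E p) (F p) (G p) (partial_u E p) (partial_v E p) (partial_u F p) (partial_v F p)
      (partial_u G p) (partial_v G p) / (E p * G p - (F p)\<^sup>2)\<^sup>2"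
  unfolding gauss_curvature_def det_bordered brioschi_num_def by simp

text \<open>The metric coefficients and all their derivatives carry the same factor
  \<open>exp u\<close>; homogeneity of degree three pulls it out.\<close>

lemma brioschi_num_scale:
  "brioschi_num (x * Evv) (x * Fuv) (x * Guu) (x * E) (x * F) (x * G)
      (x * Eu) (x * Ev) (x * Fu) (x * Fv) (x * Gu) (x * Gv) =
    x^3 * brioschi_num Evv Fuv Guu E F G Eu Ev Fu Fv Gu Gv"
  by (simp add: brioschi_num_def field_simps power2_eq_square power3_eq_cube)

text \<open>The numerators of the ODEs: \<open>e'\<close> and \<open>j'\<close> have denominator \<open>\<delta>\<close>, but \<open>f'\<close> has \<open>2 * \<delta>\<close>.\<close>

definition ode_num_e :: "real \<Rightarrow> real \<Rightarrow> real \<Rightarrow> real \<Rightarrow> real" where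
  "ode_num_e \<kappa> e j f = (\<kappa> + 1) * e * (f - \<kappa> * j)"

definition ode_num_j :: "real \<Rightarrow> real \<Rightarrow> real \<Rightarrow> real \<Rightarrow> real" where
  "ode_num_j \<kappa> e j f = j * (- j * \<kappa>\<^sup>2 + (2 * f - 2 * j) * \<kappa> + e)"

definition ode_num_f :: "real \<Rightarrow> real \<Rightarrow> real \<Rightarrow> real \<Rightarrow> real" where
  "ode_num_f \<kappa> e j f =
    - 2 * f * j * \<kappa>\<^sup>2 + (2 * f\<^sup>2 - 3 * f * j + j * e) * \<kappa> + e * (f + j)"

text \<open>The form \<open>R\<close> of the introduction; see
  \<open>curvature_numerator\<close>.\<close>

definition curvature_factor :: "real \<Rightarrow> real \<Rightarrow> real \<Rightarrow> real \<Rightarrow> real" where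
  "curvature_factor \<kappa> e j f =
    (2 * \<kappa> + 1) * e * (e - 2 * f) - \<kappa>^3 * (\<kappa> + 2) * j * (j - 2 * f)"

text \<open>Here \<open>a, b, c\<close> stand for \<open>e', j', f'\<close>.\<close>

definition profile_system :: "real \<Rightarrow> real \<Rightarrow> real \<Rightarrow> real \<Rightarrow> real \<Rightarrow> real \<Rightarrow> real \<Rightarrow> bool" where
  "profile_system \<kappa> e j f a b c \<longleftrightarrow>
    2 * e * (f - \<kappa> * c) - f * (e - \<kappa> * a) - e * a = 0 \<and>
    2 * j * c - f * b - j * (j - \<kappa> * b) = 0 \<and>
    j * (e - \<kappa> * a) + e * b - 2 * f * ((f - \<kappa> * c) + c) 
      + (3 * f - 2 * j) * a + (3 * f - 2 * e) * (j - \<kappa> * b) = 0"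

text \<open>The conclusions keep the factor \<open>d\<close>, because
  \<open>ode_delta_nonzero\<close> derives \<open>d \<noteq> 0\<close> from them in this
  form.\<close>

lemma profile_system_imp_odes:
  fixes \<kappa> e j f a b c d :: real
  assumes W: "e * j - f\<^sup>2 > 0"
   and d: "d = ode_delta \<kappa> e j f"
   and sys: "profile_system \<kappa> e j f a b c"
  shows "d * a = ode_num_e \<kappa> e j f"
   and "d * b = ode_num_j \<kappa> e j f"
   and "2 * d * c = ode_num_f \<kappa> e j f"
proof -
  let ?W = "e * j - f\<^sup>2"
  let ?h1 = "2 * e * (f - \<kappa> * c) - f * (e - \<kappa> * a) - e * a"
  let ?h2 = "2 * j * c - f * b - j * (j - \<kappa> * b)"
  let ?h3 = "j * (e - \<kappa> * a) + e * b - 2 * f * ((f - \<kappa> * c) + c) + (3 * f - 2 * j) * a + (3 * f - 2 * e) * (j - \<kappa> * b)"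
  have h1: "?h1 = 0" and h2: "?h2 = 0" and h3: "?h3 = 0"
    using sys by (simp_all add: profile_system_def)
  note d = d[unfolded ode_delta_def]
  let ?m11 = "\<kappa> * f - e" and ?m13 = "- 2 * \<kappa> * e" and ?m22 = "\<kappa> * j - f" and ?m23 = "2 * j"
    and ?m31 = "3 * f - 2 * j - \<kappa> * j" and ?m32 = "e - 3 * \<kappa> * f + 2 * \<kappa> * e" and ?m33 = "- 2 * (1 - \<kappa>) * f"
  \<comment> \<open>Cramer's rule: the multipliers are cofactors of the coefficient matrix \<open>?m\<close>.\<close>
  have "2 * ?W * (d * a - (\<kappa> + 1) * e * (f - \<kappa> * j)) =
     (?m22 * ?m33 - ?m23 * ?m32) * ?h1 + ?m13 * ?m32 * ?h2 - ?m13 * ?m22 * ?h3"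
    unfolding d by algebra
  then show "d * a = ode_num_e \<kappa> e j f"
    using W unfolding h1 h2 h3 ode_num_e_def by simp
  have "2 * ?W * (d * b - j * (- j * \<kappa>\<^sup>2 + (2 * f - 2 * j) * \<kappa> + e)) =
     ?m23 * ?m31 * ?h1 + (?m11 * ?m33 - ?m13 * ?m31) * ?h2 - ?m11 * ?m23 * ?h3"
    unfolding d by algebra
  then show "d * b = ode_num_j \<kappa> e j f"
    using W unfolding h1 h2 h3 ode_num_j_def by simp
  have "?W * (2 * d * c - (- 2 * f * j * \<kappa>\<^sup>2 + (2 * f\<^sup>2 - 3 * f * j + j * e) * \<kappa> + e * (f + j))) =
     - ?m22 * ?m31 * ?h1 - ?m11 * ?m32 * ?h2 + ?m11 * ?m22 * ?h3"
    unfolding d by algebra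
  then show "2 * d * c = ode_num_f \<kappa> e j f"
    using W unfolding h1 h2 h3 ode_num_f_def by simp
qed

text \<open>Times \<open>d\<close>, each equation is an expression in \<open>d * a\<close>,
  \<open>d * b\<close> and \<open>2 * d * c\<close>; inserting the ODEs leaves a polynomial
  identity.\<close>

lemma odes_imp_profile_system:
  fixes \<kappa> e j f a b c d :: real
  assumes d: "d = ode_delta \<kappa> e j f" "d \<noteq> 0"
   and a: "d * a = ode_num_e \<kappa> e j f"
   and b: "d * b = ode_num_j \<kappa> e j f"
   and c: "2 * d * c = ode_num_f \<kappa> e j f"
  shows "profile_system \<kappa> e j f a b c"
proof -
  note d = d[unfolded ode_delta_def] and a = a[unfolded ode_num_e_def]
    and b = b[unfolded ode_num_j_def] and c = c[unfolded ode_num_f_def]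
  have "d * (2 * e * (f - \<kappa> * c) - f * (e - \<kappa> * a) - e * a) =
      e * f * d - \<kappa> * e * (2 * d * c) + \<kappa> * f * (d * a) - e * (d * a)" by algebra
  \<comment> \<open>The ODEs rewrite the products with \<open>d\<close>, so \<open>d\<close> itself
    is expanded only afterwards.\<close>
  also have "\<dots> = 0" unfolding a b c unfolding d by algebra
  finally have 1: "2 * e * (f - \<kappa> * c) - f * (e - \<kappa> * a) - e * a = 0" using d(2) by simp
  have "d * (2 * j * c - f * b - j * (j - \<kappa> * b)) =
      j * (2 * d * c) - f * (d * b) - j^2 * d + j * \<kappa> * (d * b)" by algebra
  also have "\<dots> = 0" unfolding a b c unfolding d by algebra
  finally have 2: "2 * j * c - f * b - j * (j - \<kappa> * b) = 0" using d(2) by simp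
  have "d * (j * (e - \<kappa> * a) + e * b - 2 * f * ((f - \<kappa> * c) + c) + (3 * f - 2 * j) * a + (3 * f - 2 * e) * (j - \<kappa> * b)) =
      d * (j * e - 2 * f^2 + (3 * f - 2 * e) * j) - j * \<kappa> * (d * a) + e * (d * b) - f * (1 - \<kappa>) * (2 * d * c)
      + (3 * f - 2 * j) * (d * a) - (3 * f - 2 * e) * \<kappa> * (d * b)" by algebra
  also have "\<dots> = 0" unfolding a b c unfolding d by algebra
  finally have 3: "j * (e - \<kappa> * a) + e * b - 2 * f * ((f - \<kappa> * c) + c) + (3 * f - 2 * j) * a + (3 * f - 2 * e) * (j - \<kappa> * b) = 0"
    using d(2) by simp
  from 1 2 3 show ?thesis by (simp add: profile_system_def)
qed

text \<open>If \<open>d = 0\<close>, both numerators vanish. For \<open>\<kappa> = -1\<close> the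
  determinant \<open>e j - f\<^sup>2\<close> becomes minus a square; otherwise
  \<open>f = \<kappa> j\<close> makes it a multiple of \<open>\<kappa> (1 - \<kappa>)\<close>, a
  factor that vanishes because \<open>d\<close> does.\<close>

lemma ode_delta_nonzero:
  fixes \<kappa> e j f a b d :: real
  assumes W: "e * j - f\<^sup>2 > 0" and e: "e > 0"
   and d: "d = ode_delta \<kappa> e j f"
   and a: "d * a = ode_num_e \<kappa> e j f"
   and b: "d * b = ode_num_j \<kappa> e j f"
  shows "d \<noteq> 0"
proof
  assume 0: "d = 0"
  note d = d[unfolded ode_delta_def] and a = a[unfolded ode_num_e_def] and b = b[unfolded ode_num_j_def]
  have "e * j > 0" using W by (smt (verit) zero_le_power2)
  then have j: "j > 0" using e by (simp add: zero_less_mult_iff)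
  have B: "e = j * \<kappa>\<^sup>2 - (2 * f - 2 * j) * \<kappa>" using b j unfolding 0 by simp
  show False
  proof (cases "\<kappa> = -1")
    case True
    have "e = 2 * f - j" using d unfolding 0 True by simp
    then have "e * j - f\<^sup>2 = - (f - j)\<^sup>2" by algebra
    then show False using W by (smt (verit) zero_le_power2)
  next
    case False
    then have f: "f = \<kappa> * j" using a e unfolding 0 by simp
    have e': "e = j * \<kappa> * (2 - \<kappa>)" using B unfolding f by algebra
    have "d = 2 * j * \<kappa> * (1 - \<kappa>) * (1 + \<kappa>)" unfolding d e' f by algebra
    then have "\<kappa> * (1 - \<kappa>) = 0" using False j unfolding 0 by simp
    moreover have "e * j - f\<^sup>2 = 2 * j\<^sup>2 * (\<kappa> * (1 - \<kappa>))" unfolding e' f by algebra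
    ultimately have "e * j - f\<^sup>2 = 2 * j\<^sup>2 * 0" by (simp only:)
    then show False using W by simp
  qed
qed

section \<open>Curvature along solutions of the ODEs\<close>

text \<open>On profiles, \<open>\<partial>/\<partial>v\<close> acts as \<open>g \<mapsto> g'\<close>
  and \<open>\<partial>/\<partial>u\<close> as \<open>g \<mapsto> g - \<kappa> g'\<close>, which
  explains the arguments of \<open>brioschi_num\<close>. The second derivatives come from the
  differentiated ODEs, and \<open>4 * d^3\<close> clears all denominators.\<close>

lemma curvature_numerator:
  fixes \<kappa> e j f a b c a2 b2 c2 d :: real
  assumes d: "d = ode_delta \<kappa> e j f" "d \<noteq> 0"
   and a: "d * a = ode_num_e \<kappa> e j f"
   and b: "d * b = ode_num_j \<kappa> e j f"
   and c: "2 * d * c = ode_num_f \<kappa> e j f"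
   and dd: "dd = ode_delta \<kappa> a b c"
   and a2: "d * a2 = (\<kappa> + 1) * a * (f - \<kappa> * j) + (\<kappa> + 1) * e * (c - \<kappa> * b) - dd * a"
   and b2: "d * b2 = b * (- j * \<kappa>\<^sup>2 + (2 * f - 2 * j) * \<kappa> + e) + j * (- b * \<kappa>\<^sup>2 + (2 * c - 2 * b) * \<kappa> + a) - dd * b"
   and c2: "2 * d * c2 = - 2 * (c * j + f * b) * \<kappa>\<^sup>2 + (4 * f * c - 3 * (c * j + f * b) + b * e + j * a) * \<kappa> + a * (f + j) + e * (c + b) - 2 * dd * c"
  shows "4 * d^3 * brioschi_num a2 (c - \<kappa> * c2) (j - \<kappa> * b - \<kappa> * (b - \<kappa> * b2)) e f j
        (e - \<kappa> * a) a (f - \<kappa> * c) c (j - \<kappa> * b) b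
   = \<kappa> * (\<kappa> + 1) * (e * j - f\<^sup>2)\<^sup>2 * curvature_factor \<kappa> e j f"
proof -
  note d = d[unfolded ode_delta_def] and dd = dd[unfolded ode_delta_def] and a = a[unfolded ode_num_e_def]
    and b = b[unfolded ode_num_j_def] and c = c[unfolded ode_num_f_def]
  \<comment> \<open>\<open>A, B, C, D\<close> hide the polynomials while denominators are cleared
    and are expanded only in the last identity. \<open>D\<close> is \<open>2 * d * dd\<close>, the
    two coming from the denominator of \<open>c\<close>.\<close>
  define A where "A = (\<kappa> + 1) * e * (f - \<kappa> * j)"
  define B where "B = j * (- j * \<kappa>\<^sup>2 + (2 * f - 2 * j) * \<kappa> + e)"
  define C where "C = - 2 * f * j * \<kappa>\<^sup>2 + (2 * f\<^sup>2 - 3 * f * j + j * e) * \<kappa> + e * (f + j)"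
  define D where "D = - 2 * B * \<kappa>^3 + (C - 4 * B) * \<kappa>\<^sup>2 + (4 * A - C) * \<kappa> + 2 * A"
  have A: "a = A / d" and B: "b = B / d" and C: "c = C / (2 * d)"
    using a b c d(2) by (simp_all add: A_def B_def C_def field_simps)
  have D: "dd = D / (2 * d)" unfolding dd A B C D_def using d(2) by (simp add: field_simps)
  have A2: "4 * d^3 * a2 = 2 * d * (\<kappa> + 1) * (2 * A * (f - \<kappa> * j) + e * (C - 2 * \<kappa> * B)) - 2 * D * A" (is "_ = ?rhs")
  proof -
    have "4 * d^3 * a2 = 4 * d^2 * (d * a2)"
      by (simp add: power2_eq_square power3_eq_cube)
    also have "\<dots> = ?rhs"
      unfolding a2 unfolding A B C D using d(2)
      by (simp add: field_simps power2_eq_square power3_eq_cube)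
    finally show ?thesis .
  qed
  have B2: "4 * d^3 * b2 = d * (4 * B * (- j * \<kappa>\<^sup>2 + (2 * f - 2 * j) * \<kappa> + e) + 4 * j * (- B * \<kappa>\<^sup>2 + (C - 2 * B) * \<kappa> + A)) - 2 * D * B" (is "_ = ?rhs")
  proof -
    have "4 * d^3 * b2 = 4 * d^2 * (d * b2)"
      by (simp add: power2_eq_square power3_eq_cube)
    also have "\<dots> = ?rhs"
      unfolding b2 unfolding A B C D using d(2)
      by (simp add: field_simps power2_eq_square power3_eq_cube)
    finally show ?thesis .
  qed
  have C2: "4 * d^3 * c2 = d * (- 2 * (C * j + 2 * f * B) * \<kappa>\<^sup>2 + (4 * f * C - 3 * (C * j + 2 * f * B) + 2 * B * e + 2 * j * A) * \<kappa> + 2 * A * (f + j) + e * (C + 2 * B)) - D * C" (is "_ = ?rhs")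
  proof -
    have "4 * d^3 * c2 = 2 * d^2 * (2 * d * c2)"
      by (simp add: power2_eq_square power3_eq_cube)
    also have "\<dots> = ?rhs"
      unfolding c2 unfolding A B C D using d(2)
      by (simp add: field_simps power2_eq_square power3_eq_cube)
    finally show ?thesis .
  qed
  have "4 * d^3 * ((- a2 / 2 + (c - \<kappa> * c2) - (j - \<kappa> * b - \<kappa> * (b - \<kappa> * b2)) / 2) * (e * j - f\<^sup>2)
      - (e - \<kappa> * a) / 2 * ((c - (j - \<kappa> * b) / 2) * j - f * (b / 2))
      + ((f - \<kappa> * c) - a / 2) * ((c - (j - \<kappa> * b) / 2) * f - e * (b / 2))
      + a / 2 * (a / 2 * j - f * ((j - \<kappa> * b) / 2))
      - (j - \<kappa> * b) / 2 * (a / 2 * f - e * ((j - \<kappa> * b) / 2)))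
   = (- (4 * d^3 * a2) / 2 - \<kappa> * (4 * d^3 * c2) - \<kappa>\<^sup>2 * (4 * d^3 * b2) / 2) * (e * j - f\<^sup>2)
      + (2 * d^2 * C - 2 * j * d^3 + 4 * d^2 * \<kappa> * B) * (e * j - f\<^sup>2)
      - d * (e * d - \<kappa> * A) * ((C - j * d + \<kappa> * B) * j - f * B)
      + d * ((2 * f * d - \<kappa> * C) - A) * ((C - (j * d - \<kappa> * B)) * f - e * B)
      + d * (A * (A * j - f * (j * d - \<kappa> * B)))
      - d * ((j * d - \<kappa> * B) * (A * f - e * (j * d - \<kappa> * B)))"
    unfolding A B C using d(2)
    by (simp add: field_simps power2_eq_square power3_eq_cube)
  also have "\<dots> = \<kappa> * (\<kappa> + 1) * (e * j - f\<^sup>2)\<^sup>2 * ((2 * \<kappa> + 1) * e * (e - 2 * f) - \<kappa>^3 * (\<kappa> + 2) * j * (j - 2 * f))"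
    unfolding A2 B2 C2 unfolding A_def B_def C_def D_def d(1)
    by algebra
  finally show ?thesis unfolding brioschi_num_def curvature_factor_def .
qed

text \<open>The last assumption is \<open>\<delta>\<close> times the derivative of \<open>curvature_factor\<close> along the ODEs. Since
  \<open>curvature_factor\<close> is affine in \<open>f\<close>, it can be solved for \<open>f\<close>, and \<open>f\<close> eliminated.\<close>

lemma curvature_factor_stationary:
  fixes \<kappa> e j f d A B C :: real
  assumes W: "e * j - f\<^sup>2 > 0" and e: "e > 0" and k: "\<kappa> \<noteq> 0" "\<kappa> \<noteq> - 1"
   and d: "d = ode_delta \<kappa> e j f" "d \<noteq> 0"
   and R: "curvature_factor \<kappa> e j f = 0"
   and a: "A = ode_num_e \<kappa> e j f"
   and b: "B = ode_num_j \<kappa> e j f"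
   and c: "C = ode_num_f \<kappa> e j f"
   and S: "(2 * \<kappa> + 1) * (2 * e - 2 * f) * A - \<kappa>^3 * (\<kappa> + 2) * (2 * j - 2 * f) * B
           - ((2 * \<kappa> + 1) * e - \<kappa>^3 * (\<kappa> + 2) * j) * C = 0" (is "?S = 0")
  shows "(2 * \<kappa> + 1) * e + \<kappa>\<^sup>2 * (\<kappa> + 2) * j = 0" "2 * \<kappa> + 1 \<noteq> 0" "\<kappa> + 2 \<noteq> 0"
proof -
  note R = R[unfolded curvature_factor_def] and a = a[unfolded ode_num_e_def]
    and b = b[unfolded ode_num_j_def] and c = c[unfolded ode_num_f_def] and d = d[unfolded ode_delta_def]
  have "e * j > 0" using W by (smt (verit) zero_le_power2)
  then have j: "j > 0" using e by (simp add: zero_less_mult_iff)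
  \<comment> \<open>As a polynomial in \<open>f\<close>, \<open>curvature_factor\<close> is
    \<open>p - 2 * q * f\<close>.\<close>
  define q where "q = (2 * \<kappa> + 1) * e - \<kappa>^3 * (\<kappa> + 2) * j"
  define p where "p = (2 * \<kappa> + 1) * e\<^sup>2 - \<kappa>^3 * (\<kappa> + 2) * j\<^sup>2"
  have qf: "2 * q * f = p" using R unfolding q_def p_def by algebra
  \<comment> \<open>After elimination \<open>?S\<close> has the factor \<open>\<kappa> - 1\<close>,
    so this value is excluded first; for it \<open>d = 3 * (e - j)\<close>.\<close>
  have k1: "\<kappa> \<noteq> 1"
  proof
    assume 1: "\<kappa> = 1"
    have "(e - j) * (e + j - 2 * f) = 0" using R unfolding 1 by (simp add: algebra_simps)
    moreover have "e \<noteq> j" using d unfolding 1 by auto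
    ultimately have "2 * f = e + j" by simp
    then have "4 * (e * j - f\<^sup>2) = - (e - j)\<^sup>2" by algebra
    then show False using W by (smt (verit) zero_le_power2)
  qed
  \<comment> \<open>\<open>d\<close> is affine in \<open>f\<close>, so the factor
    \<open>2 * q\<close> lets \<open>qf\<close> eliminate \<open>f\<close>. Once \<open>q\<close> is
    nonzero, no factor of the result can vanish.\<close>
  have "2 * (q * d) = 2 * q * (- j * \<kappa>^3 - 2 * j * \<kappa>\<^sup>2 + 2 * e * \<kappa> + e) + (2 * q * f) * (\<kappa>\<^sup>2 - \<kappa>)"
    unfolding d by algebra
  also have "\<dots> = (\<kappa> + 1) * (\<kappa> + 2) * (2 * \<kappa> + 1) * (e - \<kappa>\<^sup>2 * j)\<^sup>2"
    unfolding qf unfolding p_def q_def by algebra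
  finally have qd: "2 * (q * d) = (\<kappa> + 1) * (\<kappa> + 2) * (2 * \<kappa> + 1) * (e - \<kappa>\<^sup>2 * j)\<^sup>2" .
  \<comment> \<open>If \<open>q = 0\<close>, then also \<open>p = 0\<close>, and
    \<open>e * q - p\<close> leaves only \<open>\<kappa> = -2\<close> or
    \<open>j = e\<close>.\<close>
  have q: "q \<noteq> 0"
  proof
    assume q0: "q = 0"
    then have p0: "p = 0" using qf by simp
    have "e * q - p = \<kappa>^3 * (\<kappa> + 2) * j * (j - e)" unfolding q_def p_def by algebra
    then have "\<kappa> + 2 = 0 \<or> j = e" using q0 p0 k j by simp
    then show False
    proof
      assume "\<kappa> + 2 = 0"
      then have "\<kappa> = -2" by simp
      then show False using q0 e unfolding q_def by simp
    next
      assume "j = e"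
      then have "q = - e * (\<kappa> - 1) * (\<kappa> + 1)^3" unfolding q_def by (simp add: algebra_simps eval_nat_numeral)
      then show False using q0 e k k1 by (auto simp: add_eq_0_iff)
    qed
  qed
  then have nz: "\<kappa> + 2 \<noteq> 0" "2 * \<kappa> + 1 \<noteq> 0" "e - \<kappa>\<^sup>2 * j \<noteq> 0" using qd d(2) by auto
  then show "2 * \<kappa> + 1 \<noteq> 0" "\<kappa> + 2 \<noteq> 0" by auto
  \<comment> \<open>\<open>?S\<close> has degree at most two in \<open>f\<close>, so
    \<open>4 * q\<^sup>2\<close> turns it into a polynomial in \<open>2 * q * f\<close>, which
    \<open>qf\<close> replaces by \<open>p\<close>.\<close>
  have "4 * q\<^sup>2 * ?S = (2 * \<kappa> + 1) * (4 * q * e - 2 * (2 * q * f)) * ((\<kappa> + 1) * e * (2 * q * f - 2 * q * \<kappa> * j))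
      - \<kappa>^3 * (\<kappa> + 2) * (4 * q * j - 2 * (2 * q * f)) * (j * (- 2 * q * j * \<kappa>\<^sup>2 + 2 * \<kappa> * (2 * q * f) - 4 * q * j * \<kappa> + 2 * q * e))
      - q * (- 4 * q * (2 * q * f) * j * \<kappa>\<^sup>2 + (2 * (2 * q * f)\<^sup>2 - 6 * q * (2 * q * f) * j + 4 * q\<^sup>2 * j * e) * \<kappa> + 2 * q * e * ((2 * q * f) + 2 * q * j))"
    unfolding a b c q_def[symmetric] by algebra
  also have "\<dots> = 2 * (\<kappa> + 1)^3 * (\<kappa> - 1) * (\<kappa> + 2) * (2 * \<kappa> + 1) * e * j * (e - \<kappa>\<^sup>2 * j)\<^sup>2
      * ((2 * \<kappa> + 1) * e + \<kappa>\<^sup>2 * (\<kappa> + 2) * j)" (is "_ = ?r")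
    unfolding qf unfolding p_def q_def by algebra
  finally have "?r = 0" using S by simp
  then show "(2 * \<kappa> + 1) * e + \<kappa>\<^sup>2 * (\<kappa> + 2) * j = 0"
    using q k k1 nz e j by (auto simp: add_eq_0_iff)
qed

text \<open>\<open>L\<close> fixes the ratio of \<open>e\<close> and \<open>j\<close>, and
  \<open>L'\<close> is its derivative times \<open>\<delta>\<close>. Modulo \<open>L\<close>, both
  \<open>L'\<close> and \<open>R\<close> become linear equations for \<open>f\<close>; eliminating
  \<open>f\<close> gives a second ratio, which contradicts the first.\<close>

lemma ratio_not_constant:
  fixes \<kappa> e j f d A B C :: real
  assumes e: "e > 0" and j: "j > 0" and k: "\<kappa> \<noteq> 0" "\<kappa> \<noteq> - 1"
   and R: "curvature_factor \<kappa> e j f = 0"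
   and a: "A = ode_num_e \<kappa> e j f"
   and b: "B = ode_num_j \<kappa> e j f"
   and L: "(2 * \<kappa> + 1) * e + \<kappa>\<^sup>2 * (\<kappa> + 2) * j = 0" and nz: "2 * \<kappa> + 1 \<noteq> 0" "\<kappa> + 2 \<noteq> 0"
   and L': "(2 * \<kappa> + 1) * A + \<kappa>\<^sup>2 * (\<kappa> + 2) * B = 0"
  shows False
proof -
  note R = R[unfolded curvature_factor_def] and a = a[unfolded ode_num_e_def]
    and b = b[unfolded ode_num_j_def]
  have Le: "(2 * \<kappa> + 1) * e = - (\<kappa>\<^sup>2 * (\<kappa> + 2) * j)" using L by simp
  have "(2 * \<kappa> + 1) * A + \<kappa>\<^sup>2 * (\<kappa> + 2) * B = ((2 * \<kappa> + 1) * e) * ((\<kappa> + 1) * (f - \<kappa> * j)) + \<kappa>\<^sup>2 * (\<kappa> + 2) * B"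
    unfolding a by algebra
  also have "\<dots> = \<kappa>\<^sup>2 * (\<kappa> + 2) * j * (e - \<kappa> * j - f * (1 - \<kappa>))"
    unfolding Le b by algebra
  finally have 1: "f * (1 - \<kappa>) = e - \<kappa> * j" using L' k j nz by simp
  have "(2 * \<kappa> + 1) * e * (e - 2 * f) - \<kappa>^3 * (\<kappa> + 2) * j * (j - 2 * f) = - (\<kappa>\<^sup>2 * (\<kappa> + 2) * j) * (e + \<kappa> * j - 2 * (1 + \<kappa>) * f)"
    unfolding Le by algebra
  then have 2: "2 * (1 + \<kappa>) * f = e + \<kappa> * j" using R k j nz by simp
  have "2 * (1 + \<kappa>) * (e - \<kappa> * j) = (1 - \<kappa>) * (e + \<kappa> * j)" using 1 2 by algebra
  then have 3: "(1 + 3 * \<kappa>) * e = \<kappa> * (3 + \<kappa>) * j" by algebra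
  have "(2 * \<kappa> + 1) * ((1 + 3 * \<kappa>) * e) = - (1 + 3 * \<kappa>) * (\<kappa>\<^sup>2 * (\<kappa> + 2) * j)" using Le by algebra
  then have "3 * \<kappa> * (\<kappa> + 1)^3 * j = 0" unfolding 3 by algebra
  then show False using k j by (simp add: add_eq_0_iff)
qed

section \<open>Differentiation on the open parameter set\<close>

text \<open>On a vertical line \<open>inv_coord\<close> is a translation, so a vertical slice of
  \<open>V\<close> already yields a neighbourhood of \<open>s\<close>.\<close>

lemma open_inv_coord_image:
  assumes "open V"
  shows "open (inv_coord \<kappa> ` V)"
proof (subst open_subopen, intro ballI)
  fix s assume "s \<in> inv_coord \<kappa> ` V"
  then obtain u v where p: "(u, v) \<in> V" "s = v - \<kappa> * u" by auto
  let ?T = "(\<lambda>t. (u, t + \<kappa> * u)) -` V"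
  have "open ?T" by (intro open_vimage assms continuous_intros)
  moreover have "s \<in> ?T" using p by simp
  moreover have "?T \<subseteq> inv_coord \<kappa> ` V" by force
  ultimately show "\<exists>T. open T \<and> s \<in> T \<and> T \<subseteq> inv_coord \<kappa> ` V" by blast
qed

lemma deriv_zero_on_open:
  fixes h :: "real \<Rightarrow> real"
  assumes "open I" "s \<in> I" "\<And>x. x \<in> I \<Longrightarrow> h x = 0" "(h has_real_derivative D) (at s)"
  shows "D = 0"
proof -
  have "((\<lambda>_. 0) has_real_derivative D) (at s)"
    by (rule has_field_derivative_transform_within_open[OF assms(4,1,2)]) (simp add: assms(3))
  then show ?thesis using DERIV_const DERIV_unique by blast
qed

lemma continuous_on_if_DERIV:
  fixes h :: "real \<Rightarrow> real"
  assumes "\<And>x. x \<in> S \<Longrightarrow> (h has_real_derivative D x) (at x)"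
  shows "continuous_on S h"
  using assms by (intro continuous_at_imp_continuous_on ballI DERIV_isCont)

text \<open>The form obtained by differentiating \<open>D * (N / D) = N\<close>. Keeping
  \<open>N / D\<close> on the right expresses the second derivatives of the profiles through the
  first.\<close>

lemma DERIV_quotient:
  fixes N D :: "real \<Rightarrow> real"
  assumes "(N has_real_derivative N') (at s)" "(D has_real_derivative D') (at s)" "D s \<noteq> 0"
  shows "((\<lambda>s. N s / D s) has_real_derivative (N' - D' * (N s / D s)) / D s) (at s)"
  using DERIV_divide[OF assms] assms(3) by (simp add: divide_simps mult.commute)

subsection \<open>Metrics built from solutions of the ODEs\<close>

locale lifted_C2 = lifted +
  fixes g'' :: "real \<Rightarrow> real"
  assumes deriv_g': "\<And>s. s \<in> inv_coord \<kappa> ` V \<Longrightarrow> (g' has_real_derivative g'' s) (at s)"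
    and cont_g'': "continuous_on (inv_coord \<kappa> ` V) g''"
begin

lemma cont_g': "continuous_on (inv_coord \<kappa> ` V) g'"
  using deriv_g' by (rule continuous_on_if_DERIV)

text \<open>The partial derivatives are again lifts, so \<open>u\<close> and \<open>v\<close> supply
  the second partial derivatives and their continuity.\<close>

sublocale u: lifted \<kappa> V "partial_u f" "\<lambda>s. g s - \<kappa> * g' s" "\<lambda>s. g' s - \<kappa> * g'' s"
  by unfold_locales (auto simp: open_V partial_u intro!: derivative_eq_intros deriv_g deriv_g')

sublocale v: lifted \<kappa> V "partial_v f" g' g''
  by unfold_locales (use open_V partial_v deriv_g' in auto)

lemma C2: "C2_on V f"
  unfolding C2_on_def
  by (intro conjI C1 u.C1 v.C1 continuous_intros cont_g' cont_g'')

end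

text \<open>The witnesses of \<open>reduced_form_on\<close> as fixed parameters.\<close>

locale self_similar_metric =
  fixes \<kappa> :: real and V :: "(real \<times> real) set" and E F G :: "real \<times> real \<Rightarrow> real"
    and e j f :: "real \<Rightarrow> real"
  assumes open_V: "open V"
    and E_eq: "\<And>p. p \<in> V \<Longrightarrow> E p = lift \<kappa> e p"
    and F_eq: "\<And>p. p \<in> V \<Longrightarrow> F p = lift \<kappa> f p"
    and G_eq: "\<And>p. p \<in> V \<Longrightarrow> G p = lift \<kappa> j p"
    and odes: "solves_odes_on \<kappa> (inv_coord \<kappa> ` V) e j f"
    and pos: "pos_def_metric_on V E F G"
begin

abbreviation I where "I \<equiv> inv_coord \<kappa> ` V"

text \<open>\<open>a, b, c\<close> are the derivatives of \<open>e, j, f\<close>.\<close>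

definition d where "d s = ode_delta \<kappa> (e s) (j s) (f s)"
definition a where "a s = ode_num_e \<kappa> (e s) (j s) (f s) / d s"
definition b where "b s = ode_num_j \<kappa> (e s) (j s) (f s) / d s"
definition c where "c s = ode_num_f \<kappa> (e s) (j s) (f s) / (2 * d s)"
definition d' where "d' s = ode_delta \<kappa> (a s) (b s) (c s)"
definition a' where "a' s =
  ((\<kappa> + 1) * a s * (f s - \<kappa> * j s) + (\<kappa> + 1) * e s * (c s - \<kappa> * b s) - d' s * a s) / d s"
definition b' where "b' s =
  (b s * (- j s * \<kappa>\<^sup>2 + (2 * f s - 2 * j s) * \<kappa> + e s)
    + j s * (- b s * \<kappa>\<^sup>2 + (2 * c s - 2 * b s) * \<kappa> + a s) - d' s * b s) / d s"
definition c' where "c' s =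
  (- 2 * (c s * j s + f s * b s) * \<kappa>\<^sup>2
    + (4 * f s * c s - 3 * (c s * j s + f s * b s) + b s * e s + j s * a s) * \<kappa>
    + a s * (f s + j s) + e s * (c s + b s) - 2 * d' s * c s) / (2 * d s)"

lemma odes_at:
  assumes "s \<in> I"
  shows "d s \<noteq> 0 \<and>
      (e has_real_derivative 1 / d s * (\<kappa> + 1) * e s * (f s - \<kappa> * j s)) (at s) \<and>
      (j has_real_derivative
        1 / d s * j s * (- j s * \<kappa>\<^sup>2 + (2 * f s - 2 * j s) * \<kappa> + e s)) (at s) \<and>
      (f has_real_derivative
        1 / (2 * d s) * (- 2 * f s * j s * \<kappa>\<^sup>2
          + (2 * (f s)\<^sup>2 - 3 * f s * j s + j s * e s) * \<kappa> + e s * (f s + j s))) (at s)"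
  using odes assms unfolding solves_odes_on_def Let_def d_def by (rule bspec)

lemma d_nonzero: "s \<in> I \<Longrightarrow> d s \<noteq> 0"
  using odes_at by blast

lemma
  assumes "s \<in> I"
  shows deriv_e: "(e has_real_derivative a s) (at s)"
    and deriv_j: "(j has_real_derivative b s) (at s)"
    and deriv_f: "(f has_real_derivative c s) (at s)"
  using odes_at[OF assms]
  by (simp_all add: a_def b_def c_def ode_num_e_def ode_num_j_def ode_num_f_def)

text \<open>\<open>ode_delta\<close> is linear in \<open>e, j, f\<close>, which is why
  \<open>d'\<close> is \<open>ode_delta\<close> of the derivatives.\<close>

lemma deriv_d:
  assumes "s \<in> I"
  shows "(d has_real_derivative d' s) (at s)"
  unfolding d_def[abs_def] d'_def ode_delta_def
  by (auto intro!: derivative_eq_intros deriv_e[OF assms] deriv_j[OF assms] deriv_f[OF assms]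
      simp: algebra_simps)

lemma deriv_a:
  assumes "s \<in> I"
  shows "(a has_real_derivative a' s) (at s)"
proof -
  have num: "((\<lambda>s. ode_num_e \<kappa> (e s) (j s) (f s)) has_real_derivative
      (\<kappa> + 1) * a s * (f s - \<kappa> * j s) + (\<kappa> + 1) * e s * (c s - \<kappa> * b s)) (at s)"
    unfolding ode_num_e_def
    by (auto intro!: derivative_eq_intros deriv_e[OF assms] deriv_j[OF assms] deriv_f[OF assms]
        simp: algebra_simps)
  from DERIV_quotient[OF num deriv_d[OF assms] d_nonzero[OF assms]] show ?thesis
    by (simp add: a'_def flip: a_def)
qed

lemma deriv_b:
  assumes "s \<in> I"
  shows "(b has_real_derivative b' s) (at s)"
proof -
  have num: "((\<lambda>s. ode_num_j \<kappa> (e s) (j s) (f s)) has_real_derivative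
      b s * (- j s * \<kappa>\<^sup>2 + (2 * f s - 2 * j s) * \<kappa> + e s)
      + j s * (- b s * \<kappa>\<^sup>2 + (2 * c s - 2 * b s) * \<kappa> + a s)) (at s)"
    unfolding ode_num_j_def
    by (auto intro!: derivative_eq_intros deriv_e[OF assms] deriv_j[OF assms] deriv_f[OF assms]
        simp: algebra_simps)
  from DERIV_quotient[OF num deriv_d[OF assms] d_nonzero[OF assms]] show ?thesis
    by (simp add: b'_def flip: b_def)
qed

lemma deriv_c:
  assumes "s \<in> I"
  shows "(c has_real_derivative c' s) (at s)"
proof -
  have num: "((\<lambda>s. ode_num_f \<kappa> (e s) (j s) (f s)) has_real_derivative
      - 2 * (c s * j s + f s * b s) * \<kappa>\<^sup>2
      + (4 * f s * c s - 3 * (c s * j s + f s * b s) + b s * e s + j s * a s) * \<kappa>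
      + a s * (f s + j s) + e s * (c s + b s)) (at s)"
    unfolding ode_num_f_def
    by (auto intro!: derivative_eq_intros deriv_e[OF assms] deriv_j[OF assms] deriv_f[OF assms]
        simp: algebra_simps)
  have "((\<lambda>s. 2 * d s) has_real_derivative 2 * d' s) (at s)"
    by (intro DERIV_cmult deriv_d assms)
  from DERIV_quotient[OF num this] d_nonzero[OF assms] show ?thesis
    by (simp add: c'_def flip: c_def)
qed

text \<open>The ODEs raise regularity: the profiles are only given as differentiable, but their
  derivatives are rational in them with nonvanishing denominators. This makes the metric
  \<open>C\<^sup>2\<close>.\<close>

lemma continuous_profile_derivs:
  "continuous_on I a'" "continuous_on I b'" "continuous_on I c'"
proof -
  have [continuous_intros]:
    "continuous_on I e" "continuous_on I j" "continuous_on I f" "continuous_on I d"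
    "continuous_on I a" "continuous_on I b" "continuous_on I c"
    by (rule continuous_on_if_DERIV, erule deriv_e deriv_j deriv_f deriv_d deriv_a deriv_b deriv_c)+
  have nz: "\<forall>s\<in>I. d s \<noteq> 0" "\<forall>s\<in>I. 2 * d s \<noteq> 0"
    by (intro ballI, drule d_nonzero, simp)+
  show "continuous_on I a'" "continuous_on I b'" "continuous_on I c'"
    unfolding a'_def[abs_def] b'_def[abs_def] c'_def[abs_def] d'_def ode_delta_def
    by (intro continuous_intros nz)+
qed

sublocale E: lifted_C2 \<kappa> V E e a a'
  by unfold_locales (use open_V E_eq deriv_e deriv_a continuous_profile_derivs in auto)
sublocale F: lifted_C2 \<kappa> V F f c c'
  by unfold_locales (use open_V F_eq deriv_f deriv_c continuous_profile_derivs in auto)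
sublocale G: lifted_C2 \<kappa> V G j b b'
  by unfold_locales (use open_V G_eq deriv_j deriv_b continuous_profile_derivs in auto)

lemma
  assumes "s \<in> I"
  shows e_pos: "e s > 0" and det_pos: "e s * j s - (f s)\<^sup>2 > 0"
proof -
  obtain u v where p: "(u, v) \<in> V" "s = v - \<kappa> * u" using assms by auto
  have 1: "E (u, v) > 0" "E (u, v) * G (u, v) - (F (u, v))\<^sup>2 > 0"
    using pos p(1) by (auto simp: pos_def_metric_on_def)
  show "e s > 0" using 1(1) p by (simp add: E_eq lift_def zero_less_mult_iff)
  have "E (u, v) * G (u, v) - (F (u, v))\<^sup>2 = (exp u)\<^sup>2 * (e s * j s - (f s)\<^sup>2)"
    unfolding E_eq[OF p(1)] F_eq[OF p(1)] G_eq[OF p(1)] p(2) lift_def prod.case by algebra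
  then show "e s * j s - (f s)\<^sup>2 > 0" using 1(2) by (simp add: zero_less_mult_iff)
qed

lemma j_pos: "s \<in> I \<Longrightarrow> j s > 0"
  using e_pos det_pos by (smt (verit) zero_le_power2 zero_less_mult_iff)

lemma ode_eqs:
  assumes "s \<in> I"
  shows "d s * a s = ode_num_e \<kappa> (e s) (j s) (f s)" "d s * b s = ode_num_j \<kappa> (e s) (j s) (f s)"
    "2 * d s * c s = ode_num_f \<kappa> (e s) (j s) (f s)"
  using d_nonzero[OF assms] by (simp_all add: a_def b_def c_def)

text \<open>Each equation is homogeneous of degree two in the metric and its derivatives, hence
  \<open>(exp u)\<^sup>2\<close> times an equation of \<open>profile_system\<close>. Tangency
  reduces to \<open>(g - \<kappa> g') + \<kappa> g' = g\<close>.\<close>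

lemma solves_system_and_invariant:
  assumes "p \<in> V"
  shows "2 * E p * partial_u F p - F p * partial_u E p - E p * partial_v E p = 0 \<and>
      2 * G p * partial_v F p - F p * partial_v G p - G p * partial_u G p = 0 \<and>
      G p * partial_u E p + E p * partial_v G p - 2 * F p * (partial_u F p + partial_v F p)
        + (3 * F p - 2 * G p) * partial_v E p + (3 * F p - 2 * E p) * partial_u G p = 0"
    "symmetry_field \<kappa> (graph_param E F G p) \<in> range (frechet_derivative (graph_param E F G) (at p))"
proof -
  obtain u v where p: "p = (u, v)" by (cases p)
  define s where "s = v - \<kappa> * u"
  have s: "s \<in> I" using assms p by (force simp: s_def)
  have "profile_system \<kappa> (e s) (j s) (f s) (a s) (b s) (c s)"
    by (rule odes_imp_profile_system[OF d_def d_nonzero ode_eqs]) (fact s)+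
  note sys = this[unfolded profile_system_def]
  note vals = E_eq[OF assms] F_eq[OF assms] G_eq[OF assms]
    E.partial_u[OF assms] F.partial_u[OF assms] G.partial_u[OF assms]
    E.partial_v[OF assms] F.partial_v[OF assms] G.partial_v[OF assms]
  note vals = vals[unfolded p lift_def prod.case, folded s_def]
  have "2 * E p * partial_u F p - F p * partial_u E p - E p * partial_v E p =
      (exp u)\<^sup>2 * (2 * e s * (f s - \<kappa> * c s) - f s * (e s - \<kappa> * a s) - e s * a s)"
    unfolding p vals by algebra
  moreover have "2 * G p * partial_v F p - F p * partial_v G p - G p * partial_u G p =
      (exp u)\<^sup>2 * (2 * j s * c s - f s * b s - j s * (j s - \<kappa> * b s))"
    unfolding p vals by algebra
  moreover have "G p * partial_u E p + E p * partial_v G p - 2 * F p * (partial_u F p + partial_v F p)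
        + (3 * F p - 2 * G p) * partial_v E p + (3 * F p - 2 * E p) * partial_u G p =
      (exp u)\<^sup>2 * (j s * (e s - \<kappa> * a s) + e s * b s - 2 * f s * ((f s - \<kappa> * c s) + c s)
        + (3 * f s - 2 * j s) * a s + (3 * f s - 2 * e s) * (j s - \<kappa> * b s))"
    unfolding p vals by algebra
  ultimately show "2 * E p * partial_u F p - F p * partial_u E p - E p * partial_v E p = 0 \<and>
      2 * G p * partial_v F p - F p * partial_v G p - G p * partial_u G p = 0 \<and>
      G p * partial_u E p + E p * partial_v G p - 2 * F p * (partial_u F p + partial_v F p)
        + (3 * F p - 2 * G p) * partial_v E p + (3 * F p - 2 * E p) * partial_u G p = 0"
    using sys by simp
  show "symmetry_field \<kappa> (graph_param E F G p) \<in> range (frechet_derivative (graph_param E F G) (at p))"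
    unfolding tangent_symmetry_field_iff[OF E.differentiable[OF assms] F.differentiable[OF assms] G.differentiable[OF assms]]
    unfolding p vals by (simp add: algebra_simps)
qed

section \<open>Curvature of a self-similar metric\<close>

text \<open>The numerator contributes \<open>(exp u)^3\<close> and the squared determinant
  \<open>(exp u)^4\<close>, which leaves \<open>exp (- u)\<close>; the powers of
  \<open>e j - f\<^sup>2\<close> cancel by \<open>curvature_numerator\<close>.\<close>

lemma gauss_curvature_eq:
  assumes "(u, v) \<in> V" and s: "s = v - \<kappa> * u"
  shows "gauss_curvature E F G (u, v) =
    exp (- u) * (\<kappa> * (\<kappa> + 1) * curvature_factor \<kappa> (e s) (j s) (f s) / (4 * d s ^ 3))"
proof -
  have sI: "s \<in> I" using assms by force
  note vals = E_eq[OF assms(1)] F_eq[OF assms(1)] G_eq[OF assms(1)]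
    E.v.partial_v[OF assms(1)] F.u.partial_v[OF assms(1)] G.u.partial_u[OF assms(1)]
    E.partial_u[OF assms(1)] F.partial_u[OF assms(1)] G.partial_u[OF assms(1)]
    E.partial_v[OF assms(1)] F.partial_v[OF assms(1)] G.partial_v[OF assms(1)]
  note vals = vals[unfolded lift_def prod.case, folded s]
  define W where "W = e s * j s - (f s)\<^sup>2"
  define N where "N = brioschi_num (a' s) (c s - \<kappa> * c' s) (j s - \<kappa> * b s - \<kappa> * (b s - \<kappa> * b' s))
    (e s) (f s) (j s) (e s - \<kappa> * a s) (a s) (f s - \<kappa> * c s) (c s) (j s - \<kappa> * b s) (b s)"
  define R where "R = \<kappa> * (\<kappa> + 1) * curvature_factor \<kappa> (e s) (j s) (f s)"
  have nz: "d s \<noteq> 0" "W \<noteq> 0" using d_nonzero[OF sI] det_pos[OF sI] by (auto simp: W_def)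
  have "4 * d s ^ 3 * N = \<kappa> * (\<kappa> + 1) * W\<^sup>2 * curvature_factor \<kappa> (e s) (j s) (f s)"
    unfolding N_def W_def
    by (rule curvature_numerator[OF d_def d_nonzero[OF sI] ode_eqs[OF sI] d'_def])
      (simp_all add: a'_def b'_def c'_def nz(1))
  then have "4 * d s ^ 3 * N = R * W\<^sup>2" by (simp add: R_def mult_ac)
  then have N: "N = R / (4 * d s ^ 3) * W\<^sup>2" using nz by (simp add: eq_divide_eq mult.commute)
  have "exp u * e s * (exp u * j s) - (exp u * f s)\<^sup>2 = (exp u)\<^sup>2 * W"
    by (simp add: W_def algebra_simps power2_eq_square)
  then have "gauss_curvature E F G (u, v) = ((exp u)^3 * N) / ((exp u)\<^sup>2 * W)\<^sup>2"
    unfolding gauss_curvature_eq_brioschi vals brioschi_num_scale N_def by simp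
  also have "((exp u)\<^sup>2 * W)\<^sup>2 = (exp u)^3 * (W\<^sup>2 * exp u)"
    by algebra
  also have "(exp u)^3 * N / ((exp u)^3 * (W\<^sup>2 * exp u)) = N / W\<^sup>2 / exp u"
    by simp
  also have "N / W\<^sup>2 = R / (4 * d s ^ 3)"
    unfolding N using nz by simp
  also have "R / (4 * d s ^ 3) / exp u = exp (- u) * (R / (4 * d s ^ 3))"
    by (simp only: exp_minus divide_inverse mult.commute)
  finally show ?thesis unfolding R_def .
qed

text \<open>The vanishing of \<open>curvature_factor\<close> on the open set \<open>I\<close> is
  differentiated for \<open>curvature_factor_stationary\<close>; the resulting relation between
  \<open>e\<close> and \<open>j\<close> is differentiated again for
  \<open>ratio_not_constant\<close>.\<close>

lemma curvature_not_zero: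
  assumes k: "\<kappa> \<noteq> 0" "\<kappa> \<noteq> -1" and "V \<noteq> {}" and flat: "\<And>p. p \<in> V \<Longrightarrow> gauss_curvature E F G p = 0"
  shows False
proof -
  note I = open_inv_coord_image[OF open_V, of \<kappa>]
  have R: "curvature_factor \<kappa> (e s) (j s) (f s) = 0" if s: "s \<in> I" for s
  proof -
    obtain u v where p: "(u, v) \<in> V" "s = v - \<kappa> * u" using s by auto
    show ?thesis
      using gauss_curvature_eq[OF p] flat[OF p(1)] k d_nonzero[OF s] by (simp add: add_eq_0_iff)
  qed
  have S: "(2 * \<kappa> + 1) * (2 * e s - 2 * f s) * ode_num_e \<kappa> (e s) (j s) (f s)
      - \<kappa>^3 * (\<kappa> + 2) * (2 * j s - 2 * f s) * ode_num_j \<kappa> (e s) (j s) (f s)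
      - ((2 * \<kappa> + 1) * e s - \<kappa>^3 * (\<kappa> + 2) * j s) * ode_num_f \<kappa> (e s) (j s) (f s) = 0"
    if s: "s \<in> I" for s
  proof -
    have "((\<lambda>s. curvature_factor \<kappa> (e s) (j s) (f s)) has_real_derivative
      (2 * \<kappa> + 1) * (2 * e s - 2 * f s) * a s - \<kappa>^3 * (\<kappa> + 2) * (2 * j s - 2 * f s) * b s
      - 2 * ((2 * \<kappa> + 1) * e s - \<kappa>^3 * (\<kappa> + 2) * j s) * c s) (at s)"
      unfolding curvature_factor_def
      by (auto intro!: derivative_eq_intros deriv_e[OF s] deriv_j[OF s] deriv_f[OF s]
          simp: algebra_simps)
    \<comment> \<open>The factor \<open>d\<close> turns derivatives into ODE numerators; the two in
      front of \<open>c s\<close> matches \<open>2 * d * c\<close> in the third ODE.\<close>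
    from deriv_zero_on_open[OF I s R this]
    have "d s * ((2 * \<kappa> + 1) * (2 * e s - 2 * f s) * a s - \<kappa>^3 * (\<kappa> + 2) * (2 * j s - 2 * f s) * b s
      - 2 * ((2 * \<kappa> + 1) * e s - \<kappa>^3 * (\<kappa> + 2) * j s) * c s) = 0" by simp
    then show ?thesis
      unfolding ode_eqs[OF s, symmetric] by (simp add: algebra_simps)
  qed
  note L = curvature_factor_stationary[OF det_pos e_pos k d_def d_nonzero R refl refl refl S]
  obtain s where s: "s \<in> I" using \<open>V \<noteq> {}\<close> by blast
  have "((\<lambda>s. (2 * \<kappa> + 1) * e s + \<kappa>\<^sup>2 * (\<kappa> + 2) * j s) has_real_derivative
      (2 * \<kappa> + 1) * a s + \<kappa>\<^sup>2 * (\<kappa> + 2) * b s) (at s)"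
    by (auto intro!: derivative_eq_intros deriv_e[OF s] deriv_j[OF s])
  from deriv_zero_on_open[OF I s L(1) this]
  have "d s * ((2 * \<kappa> + 1) * a s + \<kappa>\<^sup>2 * (\<kappa> + 2) * b s) = 0" by simp
  then have "(2 * \<kappa> + 1) * ode_num_e \<kappa> (e s) (j s) (f s) + \<kappa>\<^sup>2 * (\<kappa> + 2) * ode_num_j \<kappa> (e s) (j s) (f s) = 0"
    unfolding ode_eqs[OF s, symmetric] by (simp add: algebra_simps)
  then show False
    using ratio_not_constant[OF e_pos j_pos k R refl refl L] s by blast
qed

text \<open>A move in direction \<open>(1, \<kappa>)\<close> keeps \<open>v - \<kappa> u\<close> but
  rescales the curvature exponentially, which only the value zero survives.\<close>

lemma constant_curvature_zero:
  assumes "(u, v) \<in> V" and "\<And>p. p \<in> V \<Longrightarrow> gauss_curvature E F G p = K"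
  shows "K = 0"
proof -
  have "open ((\<lambda>t. (u + t, v + \<kappa> * t)) -` V)"
    by (intro open_vimage open_V continuous_intros)
  moreover have "0 \<in> (\<lambda>t. (u + t, v + \<kappa> * t)) -` V" using assms(1) by simp
  ultimately obtain r where r: "r > 0" "ball 0 r \<subseteq> (\<lambda>t. (u + t, v + \<kappa> * t)) -` V"
    using open_contains_ball by blast
  have "r / 2 \<in> ball 0 r" using r(1) by simp
  then have p: "(u + r / 2, v + \<kappa> * (r / 2)) \<in> V" using r(2) by blast
  define k where "k = \<kappa> * (\<kappa> + 1) *
    curvature_factor \<kappa> (e (v - \<kappa> * u)) (j (v - \<kappa> * u)) (f (v - \<kappa> * u)) / (4 * d (v - \<kappa> * u) ^ 3)"
  have "exp (- u) * k = K"
    using gauss_curvature_eq[OF assms(1) refl] assms(2)[OF assms(1)] by (simp add: k_def)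
  moreover have "exp (- (u + r / 2)) * k = K"
    using gauss_curvature_eq[OF p, of "v - \<kappa> * u"] assms(2)[OF p] by (simp add: k_def algebra_simps)
  ultimately have "(exp (- u) - exp (- (u + r / 2))) * k = 0" by (simp add: left_diff_distrib)
  moreover have "exp (- u) \<noteq> exp (- (u + r / 2))" using r(1) by simp
  ultimately show "K = 0" using \<open>exp (- u) * k = K\<close> by simp
qed

end

subsection \<open>Invariant solutions\<close>

lemma reduced_form_iff:
  assumes "open V" "pos_def_metric_on V E F G"
  shows "reduced_form_on \<kappa> V E F G \<longleftrightarrow> (\<exists>e j f. self_similar_metric \<kappa> V E F G e j f)"
  using assms unfolding reduced_form_on_def self_similar_metric_def lift_def by fast

lemma reduced_form_if_invariant_solution:
  assumes V: "open V" "convex V" and pos: "pos_def_metric_on V E F G"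
    and sol: "solves_system_on V E F G" and inv: "invariant_on (symmetry_field \<kappa>) V E F G"
  shows "reduced_form_on \<kappa> V E F G"
proof -
  have diff: "E differentiable (at p)" "F differentiable (at p)" "G differentiable (at p)" if "p \<in> V" for p
    using sol that by (auto simp: solves_system_on_def C2_on_def C1_on_def)
  have tangent: "partial_u E p + \<kappa> * partial_v E p = E p"
    "partial_u F p + \<kappa> * partial_v F p = F p" "partial_u G p + \<kappa> * partial_v G p = G p" if "p \<in> V" for p
    using inv that tangent_symmetry_field_iff[OF diff[OF that], of \<kappa>] by (auto simp: invariant_on_def)
  obtain e where e: "\<And>p. p \<in> V \<Longrightarrow> E p = lift \<kappa> e p"
    "\<And>p. p \<in> V \<Longrightarrow> (e has_real_derivative exp (- fst p) * partial_v E p) (at (inv_coord \<kappa> p))"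
    using profile_exists[OF V diff(1) tangent(1)] by blast
  obtain f where f: "\<And>p. p \<in> V \<Longrightarrow> F p = lift \<kappa> f p"
    "\<And>p. p \<in> V \<Longrightarrow> (f has_real_derivative exp (- fst p) * partial_v F p) (at (inv_coord \<kappa> p))"
    using profile_exists[OF V diff(2) tangent(2)] by blast
  obtain j where j: "\<And>p. p \<in> V \<Longrightarrow> G p = lift \<kappa> j p"
    "\<And>p. p \<in> V \<Longrightarrow> (j has_real_derivative exp (- fst p) * partial_v G p) (at (inv_coord \<kappa> p))"
    using profile_exists[OF V diff(3) tangent(3)] by blast
  have "solves_odes_on \<kappa> (inv_coord \<kappa> ` V) e j f"
    unfolding solves_odes_on_def Let_def
  proof
    fix s assume "s \<in> inv_coord \<kappa> ` V"
    then obtain u v where p: "(u, v) \<in> V" "s = v - \<kappa> * u" by auto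
    define a b c where "a = exp (- u) * partial_v E (u, v)" and "b = exp (- u) * partial_v G (u, v)"
      and "c = exp (- u) * partial_v F (u, v)"
    have der: "(e has_real_derivative a) (at s)" "(j has_real_derivative b) (at s)" "(f has_real_derivative c) (at s)"
      using e(2)[OF p(1)] j(2)[OF p(1)] f(2)[OF p(1)] p(2) by (simp_all add: a_def b_def c_def)
    have x: "exp u * exp (- u) = 1" by (simp add: exp_minus)
    have val: "E (u, v) = exp u * e s" "F (u, v) = exp u * f s" "G (u, v) = exp u * j s"
      using e(1)[OF p(1)] f(1)[OF p(1)] j(1)[OF p(1)] p(2) by (simp_all add: lift_def)
    have vv: "partial_v E (u, v) = exp u * a" "partial_v F (u, v) = exp u * c" "partial_v G (u, v) = exp u * b"
      using x by (simp_all add: a_def b_def c_def flip: mult.assoc)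
    \<comment> \<open>Tangency expresses the \<open>u\<close>-derivatives through the values and the
      \<open>v\<close>-derivatives.\<close>
    have uu: "partial_u E (u, v) = exp u * (e s - \<kappa> * a)" "partial_u F (u, v) = exp u * (f s - \<kappa> * c)"
      "partial_u G (u, v) = exp u * (j s - \<kappa> * b)"
      using tangent[OF p(1)] unfolding val vv by (simp_all add: algebra_simps)
    have eqs: "2 * E p * partial_u F p - F p * partial_u E p - E p * partial_v E p = 0"
      "2 * G p * partial_v F p - F p * partial_v G p - G p * partial_u G p = 0"
      "G p * partial_u E p + E p * partial_v G p - 2 * F p * (partial_u F p + partial_v F p)
        + (3 * F p - 2 * G p) * partial_v E p + (3 * F p - 2 * E p) * partial_u G p = 0" if "p \<in> V" for p
      using sol that by (auto simp: solves_system_on_def)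
    note eqs = eqs[OF p(1), unfolded val vv uu]
    have "(exp u)\<^sup>2 * (2 * e s * (f s - \<kappa> * c) - f s * (e s - \<kappa> * a) - e s * a) = 0"
      using eqs(1) by algebra
    moreover have "(exp u)\<^sup>2 * (2 * j s * c - f s * b - j s * (j s - \<kappa> * b)) = 0"
      using eqs(2) by algebra
    moreover have "(exp u)\<^sup>2 * (j s * (e s - \<kappa> * a) + e s * b - 2 * f s * ((f s - \<kappa> * c) + c)
        + (3 * f s - 2 * j s) * a + (3 * f s - 2 * e s) * (j s - \<kappa> * b)) = 0"
      using eqs(3) by algebra
    ultimately have sys: "profile_system \<kappa> (e s) (j s) (f s) a b c"
      by (simp add: profile_system_def)
    have 1: "E (u, v) > 0" "E (u, v) * G (u, v) - (F (u, v))\<^sup>2 > 0"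
      using pos p(1) by (auto simp: pos_def_metric_on_def)
    have es: "e s > 0" using 1(1) by (simp add: val zero_less_mult_iff)
    have "E (u, v) * G (u, v) - (F (u, v))\<^sup>2 = (exp u)\<^sup>2 * (e s * j s - (f s)\<^sup>2)"
      unfolding val by algebra
    then have W: "e s * j s - (f s)\<^sup>2 > 0" using 1(2) by (simp add: zero_less_mult_iff)
    let ?d = "ode_delta \<kappa> (e s) (j s) (f s)"
    note odes = profile_system_imp_odes[OF W refl sys]
    \<comment> \<open>Only now may the ODEs be divided by \<open>?d\<close>: their cleared form and
      positive definiteness exclude zero.\<close>
    have d: "?d \<noteq> 0" by (rule ode_delta_nonzero[OF W es refl odes(1,2)])
    have "a = 1 / ?d * (\<kappa> + 1) * e s * (f s - \<kappa> * j s)"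
      "b = 1 / ?d * j s * (- j s * \<kappa>\<^sup>2 + (2 * f s - 2 * j s) * \<kappa> + e s)"
      "c = 1 / (2 * ?d) * (- 2 * f s * j s * \<kappa>\<^sup>2
          + (2 * (f s)\<^sup>2 - 3 * f s * j s + j s * e s) * \<kappa> + e s * (f s + j s))"
      using odes[unfolded ode_num_e_def ode_num_j_def ode_num_f_def] d
      by (simp_all add: eq_divide_eq ac_simps)
    with d der show "?d \<noteq> 0 \<and>
      (e has_real_derivative
        1 / ?d * (\<kappa> + 1) * e s * (f s - \<kappa> * j s)) (at s) \<and>
      (j has_real_derivative
        1 / ?d * j s * (- j s * \<kappa>\<^sup>2 + (2 * f s - 2 * j s) * \<kappa> + e s)) (at s) \<and>
      (f has_real_derivative
        1 / (2 * ?d) * (- 2 * f s * j s * \<kappa>\<^sup>2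
          + (2 * (f s)\<^sup>2 - 3 * f s * j s + j s * e s) * \<kappa> + e s * (f s + j s))) (at s)"
      by simp
  qed
  then show ?thesis
    unfolding reduced_form_iff[OF V(1) pos] self_similar_metric_def using V pos e f j by blast
qed

theorem proposition15:
  fixes \<kappa> :: real
    and U :: "(real \<times> real) set"
    and E F G :: "real \<times> real \<Rightarrow> real"
  assumes "open U" and "U \<noteq> {}"
    and "pos_def_metric_on U E F G"
  shows "(solves_system_on U E F G \<and> invariant_on (symmetry_field \<kappa>) U E F G \<longleftrightarrow>
           (\<forall>V. open V \<and> convex V \<and> V \<subseteq> U \<longrightarrow> reduced_form_on \<kappa> V E F G)) \<and>
         (solves_system_on U E F G \<and> invariant_on (symmetry_field \<kappa>) U E F G \<longrightarrow>
           (gauss_curvature E F G constant_on U \<longleftrightarrow> \<kappa> \<in> {0, -1}) \<and>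
           (\<kappa> \<in> {0, -1} \<longrightarrow> flat_on U E F G))"
proof -
  let ?sol = "solves_system_on U E F G \<and> invariant_on (symmetry_field \<kappa>) U E F G"
  let ?red = "\<forall>V. open V \<and> convex V \<and> V \<subseteq> U \<longrightarrow> reduced_form_on \<kappa> V E F G"
  have pos: "pos_def_metric_on V E F G" if "V \<subseteq> U" for V
    using assms(3) that unfolding pos_def_metric_on_def by blast
  \<comment> \<open>Balls are open and convex, so the representation is available around every
    point.\<close>
  have local_profile: "\<exists>V e j f. p \<in> V \<and> V \<subseteq> U \<and> self_similar_metric \<kappa> V E F G e j f"
    if red: ?red and p: "p \<in> U" for p
  proof -
    obtain r where r: "r > 0" "ball p r \<subseteq> U"
      using openE[OF assms(1) p] by blast
    have "reduced_form_on \<kappa> (ball p r) E F G"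
      by (rule red[rule_format]) (intro conjI open_ball convex_ball r(2))
    then obtain e j f where "self_similar_metric \<kappa> (ball p r) E F G e j f"
      unfolding reduced_form_iff[OF open_ball pos[OF r(2)]] by blast
    with r show ?thesis
      by (intro exI[of _ "ball p r"]) auto
  qed
  have "?red" if sol: ?sol
  proof (intro allI impI, elim conjE)
    fix V assume V: "open V" "convex V" "V \<subseteq> U"
    have "C1_on V h" if "C1_on U h" for h
      using that V(3) by (auto simp: C1_on_def intro: continuous_on_subset)
    then have "solves_system_on V E F G"
      using sol V(3) unfolding solves_system_on_def C2_on_def by blast
    moreover have "invariant_on (symmetry_field \<kappa>) V E F G"
      using sol V(3) unfolding invariant_on_def by blast
    ultimately show "reduced_form_on \<kappa> V E F G"
      by (rule reduced_form_if_invariant_solution[OF V(1,2) pos[OF V(3)]])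
  qed
  \<comment> \<open>Regularity, the equations and tangency are local, so it suffices to check them
    on such balls.\<close>
  moreover have "?sol" if red: ?red
  proof -
    have "\<exists>V. open V \<and> p \<in> V \<and> C2_on V E \<and> C2_on V F \<and> C2_on V G" if "p \<in> U" for p
    proof -
      obtain V e j f where V: "p \<in> V" "self_similar_metric \<kappa> V E F G e j f"
        using local_profile[OF red \<open>p \<in> U\<close>] by blast
      interpret self_similar_metric \<kappa> V E F G e j f by (fact V)
      show ?thesis using open_V V(1) E.C2 F.C2 G.C2 by blast
    qed
    then have C2: "C2_on U E" "C2_on U F" "C2_on U G"
      by (auto intro!: C2_on_local[OF assms(1)])
    have eqs: "(2 * E p * partial_u F p - F p * partial_u E p - E p * partial_v E p = 0 \<and>
      2 * G p * partial_v F p - F p * partial_v G p - G p * partial_u G p = 0 \<and>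
      G p * partial_u E p + E p * partial_v G p - 2 * F p * (partial_u F p + partial_v F p)
        + (3 * F p - 2 * G p) * partial_v E p + (3 * F p - 2 * E p) * partial_u G p = 0) \<and>
      symmetry_field \<kappa> (graph_param E F G p) \<in> range (frechet_derivative (graph_param E F G) (at p))"
      if "p \<in> U" for p
    proof -
      obtain V e j f where V: "p \<in> V" "self_similar_metric \<kappa> V E F G e j f"
        using local_profile[OF red \<open>p \<in> U\<close>] by blast
      interpret self_similar_metric \<kappa> V E F G e j f by (fact V)
      show ?thesis by (rule conjI[OF solves_system_and_invariant[OF V(1)]])
    qed
    show ?thesis
      unfolding solves_system_on_def invariant_on_def using C2 eqs by blast
  qed
  \<comment> \<open>The curvature claims are derived from the representation, which every invariant
    solution has by the first part.\<close>
  moreover have "gauss_curvature E F G constant_on U \<longleftrightarrow> \<kappa> \<in> {0, -1}"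
    "\<kappa> \<in> {0, -1} \<longrightarrow> flat_on U E F G" if red: ?red
  proof -
    show flat: "\<kappa> \<in> {0, -1} \<longrightarrow> flat_on U E F G"
      unfolding flat_on_def
    proof (intro impI ballI)
      fix p assume k: "\<kappa> \<in> {0, -1}" and p: "p \<in> U"
      obtain V e j f where V: "p \<in> V" "self_similar_metric \<kappa> V E F G e j f"
        using local_profile[OF red p] by blast
      interpret self_similar_metric \<kappa> V E F G e j f by (fact V)
      obtain u v where uv: "p = (u, v)" by (cases p)
      have "\<kappa> * (\<kappa> + 1) = 0" using k by auto
      then show "gauss_curvature E F G p = 0"
        unfolding uv gauss_curvature_eq[OF V(1)[unfolded uv] refl] by simp
    qed
    show "gauss_curvature E F G constant_on U \<longleftrightarrow> \<kappa> \<in> {0, -1}"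
    proof
      assume "\<kappa> \<in> {0, -1}"
      then show "gauss_curvature E F G constant_on U"
        using flat unfolding flat_on_def constant_on_def by (intro exI[of _ 0]) simp
    next
      assume "gauss_curvature E F G constant_on U"
      then obtain K where K: "\<forall>p\<in>U. gauss_curvature E F G p = K"
        unfolding constant_on_def by (elim exE)
      \<comment> \<open>The argument needs a single ball, and \<open>U\<close> being nonempty
        provides its centre.\<close>
      obtain p where p: "p \<in> U" using assms(2) by blast
      obtain V e j f where V: "p \<in> V" "V \<subseteq> U" "self_similar_metric \<kappa> V E F G e j f"
        using local_profile[OF red p] by blast
      interpret self_similar_metric \<kappa> V E F G e j f by (fact V)
      obtain u v where uv: "p = (u, v)" by (cases p)
      have KV: "gauss_curvature E F G q = K" if "q \<in> V" for q
        using bspec[OF K subsetD[OF V(2) that]] .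
      have K0: "K = 0" by (rule constant_curvature_zero[OF V(1)[unfolded uv] KV])
      have "V \<noteq> {}" using V(1) by blast
      from curvature_not_zero[OF _ _ this KV[unfolded K0]] show "\<kappa> \<in> {0, -1}"
        by blast
    qed
  qed
  ultimately show ?thesis by argo
qed

end
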